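(* Let condition $\mathbf{L}(V,\varphi,\Psi)$ hold for the process $X$. Assume that (a) and (b) hold. (a) $h:[1,\infty)\to[1,\infty)$ is continuous and increasing (normalised, without loss of generality, by $h(1)=1$) with $\lim_{r\to\infty}h(r)=\infty$. The function $v:\mathcal X\times\mathbb R_+\to[1,\infty)$ is increasing in the second argument and satisfies $\mathbb E_x[h\circ V(X_t)]\le v(x,t)$ for all $x\in\mathcal X$ and $t\in\mathbb R_+$. (b) For $\varepsilon,q\in(0,1)$ let $L_{\varepsilon,q}(r)=r\varphi(1/r)\Psi(2r/(1-q))(\log\log r)^\varepsilon$, $r\in[1,\infty)$, and let $c_{\varepsilon,q}\in(0,1)$ be a constant such that $c_{\varepsilon,q}/L_{\varepsilon,q}(r)\le\pi(\{x\in\mathcal X: V(x)\ge r\})$ for all $r\in[1,\infty)$. The function $a:[1,\infty)\to\mathbb R_+$ is continuous and satisfies $a(t)\le c_{\varepsilon,q}/L_{\varepsilon,q}(h^{-1}(t))$ for all $t\in[1,\infty)$, where $h^{-1}$ is the inverse of $h$. The function $A(t):=t\,a(t)$ is increasing with $\lim_{t\to\infty}A(t)=\infty$; denote its inverse by $A^{-1}$. Define $r_1:\mathcal X\times[1,\infty)\to\mathbb R_+$ by $r_1:=a\circ A^{-1}\circ(2v)$. Then $$ r_1(x,t)/2\le\|\mathbb P_x(X_t\in\cdot)-\pi(\cdot)\|_{\mathrm{TV}}\qquad\text{for all }x\in\mathcal X\text{ and }t\in[1,\infty).$$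
   Context: Convention: $\mathbb R_+=[0,\infty)$; $\log x:=1$ for $x\in(0,\mathrm e)$ and $\log x$ is the natural logarithm for $x\in[\mathrm e,\infty)$; $\inf\emptyset=\infty$; "increasing/decreasing" means strictly. For a signed measure $\mu$ on $(\mathcal X,\mathcal B(\mathcal X))$, $\|\mu\|_{\mathrm{TV}}=\sup\{|\int_{\mathcal X} g\,d\mu|: g:\mathcal X\to\mathbb R\text{ measurable}, |g|\le 1\}$. Setting: $X=(X_t)_{t\in\mathbb R_+}$ is a strong Markov process with c\`adl\`ag paths on a filtered space $(\Omega,\mathcal F,(\mathcal F_t)_{t\in\mathbb R_+})$, with values in a locally compact separable metric space $\mathcal X$ with Borel $\sigma$-algebra $\mathcal B(\mathcal X)$. $\mathbb P_x,\mathbb E_x$ denote the probability and expectation with $\mathbb P_x(X_0=x)=1$. Standing assumption: $X$ is ergodic and positive Harris recurrent with invariant probability measure $\pi$, i.e. (Harris recurrence) there is a $\sigma$-finite measure $\nu$ on $\mathcal B(\mathcal X)$ such that $\nu(A)>0$ implies $\mathbb P_x(\int_0^\infty \mathbf 1\{X_t\in A\}\,dt=\infty)=1$ for all $x$; (invariance) $\int_{\mathcal X}\mathbb E_x[g(X_t)]\pi(dx)=\int_{\mathcal X} g\,d\pi$ for all bounded measurable $g:\mathcal X\to\mathbb R_+$ and $t\ge0$; (ergodicity) $\lim_{t\to\infty}\|\mathbb P_x(X_t\in\cdot)-\pi(\cdot)\|_{\mathrm{TV}}=0$ for all $x$. Condition $\mathbf L(V,\varphi,\Psi)$: $V:\mathcal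 X\to[1,\infty)$ is continuous with $\limsup_{t\to\infty}V(X_t)=\infty$ $\mathbb P_x$-a.s. for all $x\in\mathcal X$, and there exists $\ell_0\in[1,\infty)$ such that: (i) $\varphi:(0,1]\to\mathbb R_+$ is non-decreasing and continuous, $r\mapsto r\varphi(1/r)$ is decreasing on $[1,\infty)$, $\lim_{r\to\infty}r\varphi(1/r)=0$, and for some $b\in\mathbb R_+$ and any $x\in\mathcal X$ the process $1/V(X)-\int_0^\cdot\varphi(1/V(X_u))\,du-b\int_0^\cdot\mathbf 1\{V(X_u)\le\ell_0\}\,du$ is an $(\mathcal F_t)$-supermartingale under $\mathbb P_x$; (ii) $\Psi:[1,\infty)\to[1,\infty)$ is differentiable, increasing and submultiplicative (i.e. there is $C\in(0,\infty)$ with $\Psi(r_1+r_2)\le C\Psi(r_1)\Psi(r_2)$ for all $r_1,r_2\in[1,\infty)$), and for any $\ell\in(\ell_0,\infty)$ there is $C_\ell\in(0,\infty)$ with $\mathbb P_x(T^{(r)}<S_{(\ell)})\ge C_\ell/\Psi(r)$ for all $r\in(\ell+1,\infty)$ and $x\in\{\ell+1\le V\}$, where $T^{(r)}=\inf\{t\ge0:V(X_t)>r\}$ and $S_{(\ell)}=\inf\{t\ge0:V(X_t)<\ell\}$. *)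

theory Defs
  imports "HOL-Probability.Probability"
begin

section \<open>Total variation\<close>

text \<open>
  The norm of the signed measure \<open>M - N\<close> for finite measures \<open>M\<close>, \<open>N\<close> on the same
  \<open>\<sigma>\<close>-algebra. Test functions are bounded by \<open>1\<close>, so two mutually singular probability
  measures are at distance \<open>2\<close>.
\<close>

definition tv_dist :: "'x measure \<Rightarrow> 'x measure \<Rightarrow> real" where
  "tv_dist M N =
     (SUP g \<in> {g :: 'x \<Rightarrow> real. g \<in> borel_measurable M \<and> (\<forall>x\<in>space M. \<bar>g x\<bar> \<le> 1)}.
        \<bar>(\<integral>x. g x \<partial>M) - (\<integral>x. g x \<partial>N)\<bar>)"


section \<open>Processes in continuous time\<close>

text \<open>
  Time is \<open>[0,\<infinity>)\<close>; values of families \<open>F\<close>, \<open>X\<close> at negative reals are irrelevant.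
  Closing a filtration at \<open>\<infinity>\<close> by the ambient \<open>\<sigma>\<close>-algebra \<open>M\<close> gives a filtration indexed by
  \<open>[0,\<infinity>]\<close>, to which the library notions of stopping times (with value \<open>\<infinity>\<close> allowed) and
  their \<open>\<sigma>\<close>-algebras apply: at index \<open>\<infinity>\<close> they only add membership in \<open>M\<close>.
\<close>

definition closed_filtration :: "'w measure \<Rightarrow> (real \<Rightarrow> 'w measure) \<Rightarrow> ennreal \<Rightarrow> 'w measure" where
  "closed_filtration M F s = (if s = \<top> then M else F (enn2real s))"

definition cadlag :: "(real \<Rightarrow> 'x::topological_space) \<Rightarrow> bool" where
  "cadlag f \<longleftrightarrow>
     (\<forall>t\<ge>0. (f \<longlongrightarrow> f t) (at_right t)) \<and> (\<forall>t>0. \<exists>l. (f \<longlongrightarrow> l) (at_left t))"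

definition supermartingale ::
    "'w measure \<Rightarrow> (real \<Rightarrow> 'w measure) \<Rightarrow> (real \<Rightarrow> 'w \<Rightarrow> real) \<Rightarrow> bool" where
  "supermartingale M F Y \<longleftrightarrow>
     (\<forall>t\<ge>0. Y t \<in> borel_measurable (F t) \<and> integrable M (Y t)) \<and>
     (\<forall>s t. 0 \<le> s \<and> s \<le> t \<longrightarrow> (AE \<omega> in M. real_cond_exp M (F s) (Y t) \<omega> \<le> Y s \<omega>))"

text \<open>
  \<open>M\<close> only provides the measurable space on which all the laws \<open>P x\<close> live. The strong Markov
  property is stated for one later time; the version for functionals of the whole
  post-\<open>\<tau>\<close> path follows from it.
\<close>

locale strong_markov_process =
  fixes M :: "'w measure"
    and F :: "real \<Rightarrow> 'w measure"
    and P :: "'x::{metric_space, second_countable_topology} \<Rightarrow> 'w measure"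
    and X :: "real \<Rightarrow> 'w \<Rightarrow> 'x"
  assumes locally_compact_state_space: "locally compact (UNIV :: 'x set)"
    and filtration: "filtration (space M) (closed_filtration M F)"
    and prob_space_P: "\<And>x. prob_space (P x)"
    and sets_P: "\<And>x. sets (P x) = sets M"
    and adapted: "\<And>t. 0 \<le> t \<Longrightarrow> X t \<in> F t \<rightarrow>\<^sub>M borel"
    and cadlag_paths: "\<And>\<omega>. \<omega> \<in> space M \<Longrightarrow> cadlag (\<lambda>t. X t \<omega>)"
    and start: "\<And>x. AE \<omega> in P x. X 0 \<omega> = x"
    and transition_kernel:
      "\<And>t. 0 \<le> t \<Longrightarrow> (\<lambda>x. distr (P x) borel (X t)) \<in> borel \<rightarrow>\<^sub>M prob_algebra borel"
    and strong_markov: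
      "\<And>x \<tau> t (f :: 'x \<Rightarrow> real).
         stopping_time (closed_filtration M F) \<tau> \<Longrightarrow> 0 \<le> t \<Longrightarrow>
         f \<in> borel_measurable borel \<Longrightarrow> bounded (range f) \<Longrightarrow>
         AE \<omega> in P x. \<tau> \<omega> < \<top> \<longrightarrow>
           real_cond_exp (P x) (filtration.pre_sigma (space M) (closed_filtration M F) \<tau>)
             (\<lambda>\<omega>'. indicator {\<omega>'. \<tau> \<omega>' < \<top>} \<omega>' * f (X (enn2real (\<tau> \<omega>') + t) \<omega>')) \<omega>
           = (\<integral>\<omega>'. f (X t \<omega>') \<partial>P (X (enn2real (\<tau> \<omega>)) \<omega>))"

text \<open>
  The reference measure \<open>\<nu>\<close> is required to be non-zero, as usual; otherwise the notion would be
  void. For the ergodic processes below \<open>\<pi>\<close> itself can serve as \<open>\<nu>\<close>.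
\<close>

definition harris_recurrent ::
    "('x::topological_space \<Rightarrow> 'w measure) \<Rightarrow> (real \<Rightarrow> 'w \<Rightarrow> 'x) \<Rightarrow> bool" where
  "harris_recurrent P X \<longleftrightarrow>
     (\<exists>\<nu> :: 'x measure. sigma_finite_measure \<nu> \<and> sets \<nu> = sets borel \<and> emeasure \<nu> UNIV > 0 \<and>
        (\<forall>A\<in>sets borel. emeasure \<nu> A > 0 \<longrightarrow>
           (\<forall>x. AE \<omega> in P x. (\<integral>\<^sup>+t\<in>{0..}. indicator A (X t \<omega>) \<partial>lborel) = \<infinity>)))"

locale ergodic_harris_process = strong_markov_process M F P X
  for M :: "'w measure"
    and F :: "real \<Rightarrow> 'w measure"
    and P :: "'x::{metric_space, second_countable_topology} \<Rightarrow> 'w measure"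
    and X :: "real \<Rightarrow> 'w \<Rightarrow> 'x" +
  fixes \<pi> :: "'x measure"
  assumes harris: "harris_recurrent P X"
    and prob_space_\<pi>: "prob_space \<pi>"
    and sets_\<pi>: "sets \<pi> = sets borel"
    and invariant:
      "\<And>t (g :: 'x \<Rightarrow> real).
         0 \<le> t \<Longrightarrow> g \<in> borel_measurable borel \<Longrightarrow> bounded (range g) \<Longrightarrow> (\<And>x. 0 \<le> g x) \<Longrightarrow>
         (\<integral>x. (\<integral>\<omega>. g (X t \<omega>) \<partial>P x) \<partial>\<pi>) = (\<integral>x. g x \<partial>\<pi>)"
    and ergodic: "\<And>x. ((\<lambda>t. tv_dist (distr (P x) borel (X t)) \<pi>) \<longlongrightarrow> 0) at_top"


section \<open>The Lyapunov condition\<close>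

text \<open>Both hitting times are \<open>\<infinity>\<close> (= \<open>Inf {}\<close> in \<^typ>\<open>ennreal\<close>) when the level is never passed.\<close>

definition up_time :: "('x \<Rightarrow> real) \<Rightarrow> (real \<Rightarrow> 'w \<Rightarrow> 'x) \<Rightarrow> real \<Rightarrow> 'w \<Rightarrow> ennreal" where
  "up_time V X r \<omega> = Inf (ennreal ` {t. 0 \<le> t \<and> V (X t \<omega>) > r})"

definition down_time :: "('x \<Rightarrow> real) \<Rightarrow> (real \<Rightarrow> 'w \<Rightarrow> 'x) \<Rightarrow> real \<Rightarrow> 'w \<Rightarrow> ennreal" where
  "down_time V X l \<omega> = Inf (ennreal ` {t. 0 \<le> t \<and> V (X t \<omega>) < l})"

definition condition_L_i ::
    "(real \<Rightarrow> 'w measure) \<Rightarrow> ('x \<Rightarrow> 'w measure) \<Rightarrow> (real \<Rightarrow> 'w \<Rightarrow> 'x) \<Rightarrow>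
     ('x \<Rightarrow> real) \<Rightarrow> (real \<Rightarrow> real) \<Rightarrow> real \<Rightarrow> bool" where
  "condition_L_i F P X V \<phi> l\<^sub>0 \<longleftrightarrow>
     (\<forall>u\<in>{0<..1}. 0 \<le> \<phi> u) \<and> mono_on {0<..1} \<phi> \<and> continuous_on {0<..1} \<phi> \<and>
     strict_antimono_on {1..} (\<lambda>r. r * \<phi> (1 / r)) \<and>
     ((\<lambda>r. r * \<phi> (1 / r)) \<longlongrightarrow> 0) at_top \<and>
     (\<exists>b\<ge>0. \<forall>x. supermartingale (P x) F
        (\<lambda>t \<omega>. 1 / V (X t \<omega>)
               - (LINT u:{0..t}|lborel. \<phi> (1 / V (X u \<omega>)))
               - b * (LINT u:{0..t}|lborel. indicator {y. V y \<le> l\<^sub>0} (X u \<omega>))))"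

definition condition_L_ii ::
    "('x \<Rightarrow> 'w measure) \<Rightarrow> (real \<Rightarrow> 'w \<Rightarrow> 'x) \<Rightarrow>
     ('x \<Rightarrow> real) \<Rightarrow> (real \<Rightarrow> real) \<Rightarrow> real \<Rightarrow> bool" where
  "condition_L_ii P X V \<Psi> l\<^sub>0 \<longleftrightarrow>
     (\<forall>r\<ge>1. 1 \<le> \<Psi> r) \<and> \<Psi> differentiable_on {1..} \<and> strict_mono_on {1..} \<Psi> \<and>
     (\<exists>C>0. \<forall>r\<^sub>1\<ge>1. \<forall>r\<^sub>2\<ge>1. \<Psi> (r\<^sub>1 + r\<^sub>2) \<le> C * \<Psi> r\<^sub>1 * \<Psi> r\<^sub>2) \<and>
     (\<forall>l>l\<^sub>0. \<exists>C>0. \<forall>r>l + 1. \<forall>x. l + 1 \<le> V x \<longrightarrow>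
        \<P>(\<omega> in P x. up_time V X r \<omega> < down_time V X l \<omega>) \<ge> C / \<Psi> r)"

definition condition_L ::
    "(real \<Rightarrow> 'w measure) \<Rightarrow> ('x::topological_space \<Rightarrow> 'w measure) \<Rightarrow> (real \<Rightarrow> 'w \<Rightarrow> 'x) \<Rightarrow>
     ('x \<Rightarrow> real) \<Rightarrow> (real \<Rightarrow> real) \<Rightarrow> (real \<Rightarrow> real) \<Rightarrow> bool" where
  "condition_L F P X V \<phi> \<Psi> \<longleftrightarrow>
     (\<forall>x. 1 \<le> V x) \<and> continuous_on UNIV V \<and>
     (\<forall>x. AE \<omega> in P x. Limsup at_top (\<lambda>t. ereal (V (X t \<omega>))) = \<infinity>) \<and>
     (\<exists>l\<^sub>0\<ge>1. condition_L_i F P X V \<phi> l\<^sub>0 \<and> condition_L_ii P X V \<Psi> l\<^sub>0)"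


section \<open>Rate functions\<close>

definition clog :: "real \<Rightarrow> real" where
  "clog x = (if x < exp 1 then 1 else ln x)"

definition L_fun :: "(real \<Rightarrow> real) \<Rightarrow> (real \<Rightarrow> real) \<Rightarrow> real \<Rightarrow> real \<Rightarrow> real \<Rightarrow> real" where
  "L_fun \<phi> \<Psi> \<epsilon> q r =
     r * \<phi> (1 / r) * \<Psi> (2 * r / (1 - q)) * clog (clog r) powr \<epsilon>"

text \<open>
  The functions \<open>h\<close> and \<open>A t = t * a t\<close> live on \<open>[1,\<infinity>)\<close>; this is their inverse on the image
  of that half-line.
\<close>

abbreviation inv_ge1 :: "(real \<Rightarrow> real) \<Rightarrow> real \<Rightarrow> real" where
  "inv_ge1 \<equiv> the_inv_into {1..}"

definition r1_fun :: "(real \<Rightarrow> real) \<Rightarrow> ('x \<Rightarrow> real \<Rightarrow> real) \<Rightarrow> 'x \<Rightarrow> real \<Rightarrow> real" where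
  "r1_fun a v x t = a (inv_ge1 (\<lambda>s. s * a s) (2 * v x t))"

end

theory Submission
  imports Defs
begin

text \<open>
  The total variation distance dominates the difference of the masses that two probability
  measures give to a single event. Here the event is a tail \<open>{V \<ge> r}\<close>, which for \<open>r\<close>
  large enough in terms of \<open>t\<close> is heavier under \<open>\<pi>\<close> than under the law of \<open>X t\<close>.

  Put \<open>s = h r\<close>. The lower bound on the tails of \<open>\<pi>\<close> and the choice of \<open>a\<close> give
  \<open>a s \<le> \<pi> {V \<ge> r}\<close>, while Markov's inequality for \<open>h (V (X t))\<close> (\<open>prob_ge_le_moment\<close>) gives
  \<open>P x {V (X t) \<ge> r} \<le> v x t / s\<close>. The difference is therefore at least \<open>a s - v x t / s\<close>, and
  the level \<open>s\<close> with \<open>s * a s = 2 * v x t\<close> turns this into \<open>a s / 2\<close>, which is half of the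
  rate function. Such a level exists by the intermediate value theorem (\<open>inv_ge1_works\<close>):
  \<open>s * a s\<close> is continuous and unbounded, and at \<open>s = 1\<close> it is at most a probability, hence
  below \<open>2 * v x t\<close>.
\<close>

text \<open>
  The indicator of the event is an admissible test function. The supremum is over a set of
  reals, so it bounds its elements only because all of them are at most \<open>2\<close>.
\<close>

lemma tv_dist_ge_event:
  assumes "prob_space M" "prob_space N" and sets_eq: "sets M = sets N" and "A \<in> sets M"
  shows "measure N A - measure M A \<le> tv_dist M N"
proof -
  interpret M: prob_space M by fact
  interpret N: prob_space N by fact
  define G where "G = {g :: 'a \<Rightarrow> real. g \<in> borel_measurable M \<and> (\<forall>x\<in>space M. \<bar>g x\<bar> \<le> 1)}"
  have space_eq: "space M = space N"
    using sets_eq by (rule sets_eq_imp_space_eq)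
  have integral_le_1: "\<bar>\<integral>x. g x \<partial>Q\<bar> \<le> 1"
    if "prob_space Q" "\<forall>x\<in>space Q. \<bar>g x\<bar> \<le> 1" for Q :: "'a measure" and g :: "'a \<Rightarrow> real"
  proof -
    interpret Q: prob_space Q by fact
    have "norm (\<integral>x. g x \<partial>Q) \<le> (\<integral>x. norm (g x) \<partial>Q)"
      by (rule integral_norm_bound)
    also have "\<dots> \<le> (\<integral>x. 1 \<partial>Q)"
      using that(2) by (intro integral_mono') auto
    finally show ?thesis
      by (simp add: Q.prob_space)
  qed
  have "bdd_above ((\<lambda>g. \<bar>(\<integral>x. g x \<partial>M) - (\<integral>x. g x \<partial>N)\<bar>) ` G)"
  proof (rule bdd_aboveI2)
    fix g assume "g \<in> G"
    then have "\<bar>\<integral>x. g x \<partial>M\<bar> \<le> 1" "\<bar>\<integral>x. g x \<partial>N\<bar> \<le> 1"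
      using integral_le_1[OF assms(1), of g] integral_le_1[OF assms(2), of g] space_eq
      by (auto simp: G_def)
    then show "\<bar>(\<integral>x. g x \<partial>M) - (\<integral>x. g x \<partial>N)\<bar> \<le> 2"
      by linarith
  qed
  moreover have "indicator A \<in> G"
    using \<open>A \<in> sets M\<close> by (auto simp: G_def indicator_def)
  ultimately have "\<bar>(\<integral>x. indicator A x \<partial>M) - (\<integral>x. indicator A x \<partial>N)\<bar> \<le> tv_dist M N"
    unfolding tv_dist_def G_def[symmetric] by (rule cSUP_upper[rotated])
  then show ?thesis
    using assms(4) sets_eq by (simp add: abs_le_iff)
qed

lemma inv_ge1_works:
  fixes f :: "real \<Rightarrow> real"
  assumes "continuous_on {1..} f" and incr: "strict_mono_on {1..} f"
    and lim: "filterlim f at_top at_top" and "f 1 \<le> y"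
  shows "1 \<le> inv_ge1 f y" "f (inv_ge1 f y) = y"
proof -
  have "eventually (\<lambda>u. y \<le> f u \<and> 1 \<le> u) at_top"
    using lim by (auto simp: filterlim_at_top intro: eventually_conj eventually_ge_at_top)
  then obtain u where u: "y \<le> f u" "1 \<le> u"
    by (metis (no_types, lifting) eventually_happens trivial_limit_at_top_linorder)
  have "\<exists>s. 1 \<le> s \<and> s \<le> u \<and> f s = y"
    using assms u by (intro IVT') (auto elim: continuous_on_subset)
  then have img: "y \<in> f ` {1..}"
    by auto
  have inj: "inj_on f {1..}"
    using incr by (rule strict_mono_on_imp_inj_on)
  show "1 \<le> inv_ge1 f y"
    using the_inv_into_into[OF inj img subset_refl] by simp
  show "f (inv_ge1 f y) = y"
    using inj img by (rule f_the_inv_into_f)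
qed

text \<open>
  By monotonicity, \<open>h r\<close> times the indicator of \<open>{Y \<ge> r}\<close> lies below \<open>h \<circ> Y\<close>; integrating
  this gives Markov's inequality directly for the level sets of \<open>Y\<close>.
\<close>

lemma prob_ge_le_moment:
  fixes h :: "real \<Rightarrow> real" and Y :: "'w \<Rightarrow> real"
  assumes "prob_space Q" and meas: "{\<omega> \<in> space Q. r \<le> Y \<omega>} \<in> sets Q"
    and mono: "mono_on {1..} h" and "1 \<le> r" "0 < h r" "0 \<le> m"
    and moment: "(\<integral>\<^sup>+\<omega>. ennreal (h (Y \<omega>)) \<partial>Q) \<le> ennreal m"
  shows "measure Q {\<omega> \<in> space Q. r \<le> Y \<omega>} \<le> m / h r"
proof -
  interpret prob_space Q by fact
  let ?E = "{\<omega> \<in> space Q. r \<le> Y \<omega>}"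
  have "ennreal (h r * measure Q ?E) = ennreal (h r) * emeasure Q ?E"
    using \<open>0 < h r\<close> by (simp add: emeasure_eq_measure ennreal_mult)
  also have "\<dots> = (\<integral>\<^sup>+\<omega>. ennreal (h r) * indicator ?E \<omega> \<partial>Q)"
    using meas by (rule nn_integral_cmult_indicator[symmetric])
  also have "\<dots> \<le> (\<integral>\<^sup>+\<omega>. ennreal (h (Y \<omega>)) \<partial>Q)"
    using mono \<open>1 \<le> r\<close>
    by (intro nn_integral_mono) (auto simp: indicator_def mono_on_def intro!: ennreal_leI)
  also have "\<dots> \<le> ennreal m"
    by (rule moment)
  finally have "h r * measure Q ?E \<le> m"
    using \<open>0 \<le> m\<close> by (simp add: ennreal_le_iff)
  then show ?thesis
    using \<open>0 < h r\<close> by (simp add: field_simps)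
qed

theorem corollary2p3:
  fixes M :: "'w measure"
    and F :: "real \<Rightarrow> 'w measure"
    and P :: "'x::{metric_space, second_countable_topology} \<Rightarrow> 'w measure"
    and X :: "real \<Rightarrow> 'w \<Rightarrow> 'x"
    and \<pi> :: "'x measure"
    and V :: "'x \<Rightarrow> real"
    and \<phi> \<Psi> h a :: "real \<Rightarrow> real"
    and v :: "'x \<Rightarrow> real \<Rightarrow> real"
    and \<epsilon> q c :: real
  assumes process: "ergodic_harris_process M F P X \<pi>"
    and L: "condition_L F P X V \<phi> \<Psi>"
    and h_range: "\<And>r. 1 \<le> r \<Longrightarrow> 1 \<le> h r"
    and h_cont: "continuous_on {1..} h"
    and h_incr: "strict_mono_on {1..} h"
    and h_one: "h 1 = 1"
    and h_lim: "filterlim h at_top at_top"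
    and v_range: "\<And>x t. 0 \<le> t \<Longrightarrow> 1 \<le> v x t"
    and v_incr: "\<And>x. strict_mono_on {0..} (v x)"
    and v_bound: "\<And>x t. 0 \<le> t \<Longrightarrow> (\<integral>\<^sup>+\<omega>. ennreal (h (V (X t \<omega>))) \<partial>P x) \<le> ennreal (v x t)"
    and eps: "0 < \<epsilon>" "\<epsilon> < 1"
    and q: "0 < q" "q < 1"
    and c: "0 < c" "c < 1"
    and c_bound: "\<And>r. 1 \<le> r \<Longrightarrow> c / L_fun \<phi> \<Psi> \<epsilon> q r \<le> measure \<pi> {x. V x \<ge> r}"
    and a_range: "\<And>t. 1 \<le> t \<Longrightarrow> 0 \<le> a t"
    and a_cont: "continuous_on {1..} a"
    and a_bound: "\<And>t. 1 \<le> t \<Longrightarrow> a t \<le> c / L_fun \<phi> \<Psi> \<epsilon> q (inv_ge1 h t)"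
    and A_incr: "strict_mono_on {1..} (\<lambda>t. t * a t)"
    and A_lim: "filterlim (\<lambda>t. t * a t) at_top at_top"
  shows "\<forall>x. \<forall>t\<ge>1. r1_fun a v x t / 2 \<le> tv_dist (distr (P x) borel (X t)) \<pi>"
proof (intro allI impI)
  fix x and t :: real
  assume "1 \<le> t"
  interpret ergodic_harris_process M F P X \<pi> by (rule process)
  interpret \<pi>: prob_space \<pi> by (rule prob_space_\<pi>)
  interpret Px: prob_space "P x" by (rule prob_space_P)
  have V_cont: "continuous_on UNIV V"
    using L by (simp add: condition_L_def)
  then have V_meas: "V \<in> borel_measurable borel"
    by (rule borel_measurable_continuous_onI)
  have X_meas: "X t \<in> P x \<rightarrow>\<^sub>M borel"
  proof -
    \<comment> \<open>At index \<open>\<top>\<close> the closed filtration is \<open>M\<close> itself.\<close>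
    have "subalgebra M (closed_filtration M F (ennreal t))"
    proof -
      interpret filt: filtration "space M" "closed_filtration M F"
        by (rule filtration)
      show ?thesis
        using filt.sets_F_mono[of "ennreal t" \<top>] filt.space_F[of "ennreal t"]
        by (simp add: subalgebra_def closed_filtration_def)
    qed
    then have "subalgebra (P x) (F t)"
      using \<open>1 \<le> t\<close> sets_P[of x] sets_eq_imp_space_eq[OF sets_P[of x]]
      by (simp add: subalgebra_def closed_filtration_def)
    then show ?thesis
      using adapted[of t] \<open>1 \<le> t\<close> by (auto intro: measurable_from_subalg)
  qed

  define s where "s = inv_ge1 (\<lambda>s. s * a s) (2 * v x t)"
  define r where "r = inv_ge1 h s"
  have tail: "a (h r) \<le> measure \<pi> {y. r \<le> V y}" if "1 \<le> r" for r
  proof -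
    have "inv_ge1 h (h r) = r"
      using strict_mono_on_imp_inj_on[OF h_incr] that by (simp add: the_inv_into_f_f)
    then show ?thesis
      using a_bound[of "h r"] c_bound[of r] h_range[of r] that by simp
  qed
  \<comment> \<open>Since \<open>h 1 = 1\<close>, the tail bound at level \<open>1\<close> bounds \<open>a 1\<close> by a probability.\<close>
  have "1 * a 1 \<le> 2 * v x t"
  proof -
    have "a 1 \<le> 1"
      using tail[of 1] h_one by (auto intro: order_trans[OF _ \<pi>.prob_le_1])
    then show ?thesis
      using v_range[of t x] \<open>1 \<le> t\<close> by simp
  qed
  moreover have "continuous_on {1..} (\<lambda>s. s * a s)"
    using a_cont by (intro continuous_intros)
  ultimately have s: "1 \<le> s" "s * a s = 2 * v x t"
    using inv_ge1_works[of "\<lambda>s. s * a s"] A_incr A_lim by (auto simp: s_def)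
  have r: "1 \<le> r" "h r = s"
    using inv_ge1_works[of h s] h_cont h_incr h_lim h_one s(1) by (auto simp: r_def)

  have pre: "{\<omega> \<in> space (P x). r \<le> V (X t \<omega>)} \<in> sets (P x)"
    using X_meas V_meas by measurable
  have tail_set: "{y. r \<le> V y} \<in> sets borel"
    using V_meas by measurable
  have "measure (distr (P x) borel (X t)) {y. r \<le> V y}
        = measure (P x) {\<omega> \<in> space (P x). r \<le> V (X t \<omega>)}"
    using X_meas tail_set by (simp add: measure_distr vimage_def Int_def conj_commute)
  also have "\<dots> \<le> v x t / h r"
    using pre h_incr r s(1) v_range[of t x] v_bound[of t x] \<open>1 \<le> t\<close>
    by (intro prob_ge_le_moment) (auto intro: prob_space_P strict_mono_on_imp_mono_on)
  also have "\<dots> = a s / 2"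
    using s r by (simp add: field_simps)
  finally have "a s / 2 \<le> measure \<pi> {y. r \<le> V y} - measure (distr (P x) borel (X t)) {y. r \<le> V y}"
    using tail[OF r(1)] r(2) by simp
  also have "\<dots> \<le> tv_dist (distr (P x) borel (X t)) \<pi>"
    using tail_set sets_\<pi> by (intro tv_dist_ge_event)
      (auto intro: Px.prob_space_distr X_meas prob_space_\<pi>)
  finally show "r1_fun a v x t / 2 \<le> tv_dist (distr (P x) borel (X t)) \<pi>"
    by (simp add: r1_fun_def s_def)
qed

end
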